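(* In the setting described in the context (true parameter $\xi_0\in\Xi$, sampling $h_n\to0$, $T_n=nh_n\to\infty$), assume: (A1) There exist constants $C>0$ and $\alpha\in(0,2]$ such that for all $n$, $\sup_{1\le i\le n}\sum_{j=1}^n|\mathrm{Cov}(\Delta_i^nZ,\Delta_j^nZ)|\le C h_n^\alpha$. (B1) For every $t\ge0$, the map $\xi\mapsto\mu_\xi(t)$ is continuous on $\overline{\Xi}$. (B3) There exists $C>0$ such that $\sup_{\xi\in\overline{\Xi}}\sup_{t\ge0}|\partial_t\mu_\xi(t)|\le C$ (the time derivative being assumed to exist). (B4) There exist a deterministic sequence $a_n\to\infty$ and a nonnegative continuous function $Q:\overline{\Xi}\times\overline{\Xi}\to[0,\infty)$ such that $$\sup_{\xi\in\overline{\Xi}}\left|\frac1{a_n}\sum_{i=1}^n\bigl(\mu_\xi(t_{i-1})-\mu_{\xi_0}(t_{i-1})\bigr)^2-Q(\xi,\xi_0)\right|\to0,$$ and, for $\xi\in\overline{\Xi}$, $Q(\xi,\xi_0)=0$ if and only if $\xi=\xi_0$. (B5) The gradient $\partial_\xi\mu_\xi(t)$ exists, and there exist a deterministic sequence $b_n\to\infty$ and a measurable function $M:[0,\infty)\to[0,\infty)$ such that $\sup_{\xi\in\overline{\Xi}}|\partial_\xi\mu_\xi(t)|\le M(t)$ for all $t\ge0$ and $\frac1{b_n}\sum_{i=1}^nM(t_{i-1})^2=O(1)$ as $n\to\infty$. Assume moreover that, as $n\to\infty$, $$a_nh_n^{2-\alpha}\to\infty,\qquad \frac{nh_n^2}{a_n}\to0,\qquad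 b_n=O(a_n).$$ Then $\widehat{\xi}_n\to\xi_0$ in probability as $n\to\infty$.
   Context: Let $\Xi\subset\mathbb{R}^p$ be an open bounded convex set with closure $\overline{\Xi}$, and let $\{\mu_\xi:[0,\infty)\to\mathbb{R}\mid\xi\in\overline{\Xi}\}$ be a family of deterministic functions (drifts) with $\int_0^t|\mu_\xi(s)|\,ds<\infty$ for all $t>0$. Let $Z=(Z_t)_{t\ge0}$ be a centered stationary Gaussian process with covariance kernel $K$, i.e. $\mathbb{E}[Z_tZ_s]=K(|t-s|)$. For a true parameter $\xi_0\in\Xi$, the observed process is $$X_t=Z_t+\int_0^t\mu_{\xi_0}(s)\,ds,\qquad t\ge0.$$ For each $n$, $X$ is observed at $t_i=ih_n$, $i=0,1,\dots,n$, where $h_n>0$, $h_n\to0$ and $T_n:=nh_n\to\infty$ as $n\to\infty$. For $Y=X,Z$ write $\Delta_i^nY=Y_{t_i}-Y_{t_{i-1}}$, $i=1,\dots,n$. The contrast function is $H_n(\xi)=\sum_{i=1}^n\bigl(\Delta_i^nX-\mu_\xi(t_{i-1})h_n\bigr)^2$, and the estimator is any (measurable) minimizer $\widehat{\xi}_n\in\arg\min_{\xi\in\overline{\Xi}}H_n(\xi)$. $\partial_\xi$ denotes the gradient in $\xi$ (a column vector) and $|\cdot|$ the Euclidean norm. *)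

theory Defs
  imports "HOL-Probability.Probability" "HOL-Library.Landau_Symbols"
begin

(* Point masses are counted as (degenerate) Gaussian laws: linear combinations of the values of a
   Gaussian process may have variance 0. *)
definition gaussian_rv :: "'a measure \<Rightarrow> ('a \<Rightarrow> real) \<Rightarrow> bool" where
  "gaussian_rv M X \<longleftrightarrow> X \<in> borel_measurable M \<and>
     ((\<exists>m. AE \<omega> in M. X \<omega> = m) \<or>
      (\<exists>m \<sigma>. \<sigma> > 0 \<and> distributed M lborel X (normal_density m \<sigma>)))"

definition gaussian_process :: "'a measure \<Rightarrow> real set \<Rightarrow> (real \<Rightarrow> 'a \<Rightarrow> real) \<Rightarrow> bool" where
  "gaussian_process M T Z \<longleftrightarrow>
     (\<forall>J c. finite J \<and> J \<subseteq> T \<longrightarrow> gaussian_rv M (\<lambda>\<omega>. \<Sum>t\<in>J. c t * Z t \<omega>))"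

definition centered_stationary_gaussian_process ::
  "'a measure \<Rightarrow> (real \<Rightarrow> real) \<Rightarrow> (real \<Rightarrow> 'a \<Rightarrow> real) \<Rightarrow> bool" where
  "centered_stationary_gaussian_process M K Z \<longleftrightarrow>
     gaussian_process M {0..} Z \<and>
     (\<forall>t\<ge>0. integral\<^sup>L M (Z t) = 0) \<and>
     (\<forall>t\<ge>0. \<forall>s\<ge>0. integral\<^sup>L M (\<lambda>\<omega>. Z t \<omega> * Z s \<omega>) = K \<bar>t - s\<bar>)"

definition covariance :: "'a measure \<Rightarrow> ('a \<Rightarrow> real) \<Rightarrow> ('a \<Rightarrow> real) \<Rightarrow> real" where
  "covariance M X Y =
     integral\<^sup>L M (\<lambda>\<omega>. (X \<omega> - integral\<^sup>L M X) * (Y \<omega> - integral\<^sup>L M Y))"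

definition converges_in_probability ::
  "'a measure \<Rightarrow> (nat \<Rightarrow> 'a \<Rightarrow> 'b::metric_space) \<Rightarrow> ('a \<Rightarrow> 'b) \<Rightarrow> bool" where
  "converges_in_probability M X Y \<longleftrightarrow>
     (\<forall>\<epsilon>>0. (\<lambda>n. measure M {\<omega> \<in> space M. dist (X n \<omega>) (Y \<omega>) > \<epsilon>}) \<longlonglongrightarrow> 0)"

(* The drift is only given for parameters in a closed convex set with nonempty interior, so
   the gradient is taken within that set; it is unique there, and at interior points it is
   the usual gradient. *)
definition has_gradient_within ::
  "('b::euclidean_space \<Rightarrow> real) \<Rightarrow> 'b \<Rightarrow> 'b \<Rightarrow> 'b set \<Rightarrow> bool" where
  "has_gradient_within f g x S \<longleftrightarrow> (f has_derivative (\<lambda>v. g \<bullet> v)) (at x within S)"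

definition observed ::
  "('b \<Rightarrow> real \<Rightarrow> real) \<Rightarrow> 'b \<Rightarrow> (real \<Rightarrow> 'a \<Rightarrow> real) \<Rightarrow> real \<Rightarrow> 'a \<Rightarrow> real" where
  "observed \<mu> \<xi>\<^sub>0 Z t \<omega> = Z t \<omega> + (LINT s:{0..t}|lborel. \<mu> \<xi>\<^sub>0 s)"

definition tgrid :: "(nat \<Rightarrow> real) \<Rightarrow> nat \<Rightarrow> nat \<Rightarrow> real" where
  "tgrid h n i = real i * h n"

(* Only used for i \<ge> 1. *)
definition increment ::
  "(nat \<Rightarrow> real) \<Rightarrow> (real \<Rightarrow> 'a \<Rightarrow> real) \<Rightarrow> nat \<Rightarrow> nat \<Rightarrow> 'a \<Rightarrow> real" where
  "increment h Y n i \<omega> = Y (tgrid h n i) \<omega> - Y (tgrid h n (i - 1)) \<omega>"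

definition contrast ::
  "('b \<Rightarrow> real \<Rightarrow> real) \<Rightarrow> (nat \<Rightarrow> real) \<Rightarrow> (real \<Rightarrow> 'a \<Rightarrow> real) \<Rightarrow> nat \<Rightarrow> 'a \<Rightarrow> 'b \<Rightarrow> real" where
  "contrast \<mu> h X n \<omega> \<xi> =
     (\<Sum>i=1..n. (increment h X n i \<omega> - \<mu> \<xi> (tgrid h n (i - 1)) * h n)\<^sup>2)"

end

theory Submission
  imports Defs
begin

text \<open>
  Why the estimator is consistent. Let \<open>V n \<xi>\<close> be \<open>1 / a n\<close> times the sum of squared differences
  of the drifts of \<open>\<xi>\<close> and of the true parameter on the observation grid, and let \<open>G n \<xi>\<close> be
  \<open>1 / (a n * h n)\<close> times the sum of these differences multiplied by the increments of the noise.
  Comparing the contrast at its minimizer with the contrast at the true parameter yields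
  \<open>V n \<xi> \<le> 4 * G n \<xi> + 4 * C\<^sup>2 * n * (h n)\<^sup>2 / a n\<close> at the minimizer
  (\<open>contrast_minimizer_inequality\<close>), where \<open>C\<close> bounds the time derivative of the drift. The last
  term vanishes by the rate condition. Away from the true parameter \<open>V n\<close> is eventually bounded
  below by a positive constant, because it converges uniformly to a limit that is continuous and
  has its only zero at the true parameter. So the minimizer has to be close to the true parameter
  as soon as \<open>G n\<close> is uniformly small, and it remains to show that the supremum of \<open>G n\<close> vanishes
  in probability.

  The variance of \<open>G n u - G n v\<close> is at most a constant times
  \<open>(dist u v)\<^sup>2 / (a n * h n powr (2 - \<alpha>))\<close>: the row sums of the covariance matrix of the increments
  are of order \<open>h n powr \<alpha>\<close> (\<open>sum_squares_le_row_sums\<close>), and the drift is Lipschitz in the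
  parameter with a constant that is square summable along the grid up to order \<open>b n\<close>, hence up to
  order \<open>a n\<close>. Summing the absolute values of the noise increments pathwise would lose the
  cancellation among them and give a modulus of continuity that the rate conditions do not
  control. Instead, Gaussianity upgrades
  the variance bound to moments of any order (\<open>centered_gaussian_even_moment\<close>), and an order that
  is large compared with the dimension makes a chaining argument over finite nets work
  (\<open>chaining_maximal_inequality\<close>). The chain starts at the true parameter, where \<open>G n\<close> is 0.
\<close>

section \<open>Gaussian variables and processes\<close>

lemma gaussian_rv_integrable_square:
  assumes "prob_space P" "gaussian_rv P X"
  shows "integrable P X" "integrable P (\<lambda>\<omega>. (X \<omega>)\<^sup>2)"
proof -
  interpret prob_space P by fact
  have meas[measurable]: "X \<in> borel_measurable P"
    using assms(2) by (auto simp: gaussian_rv_def)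
  have "\<exists>m. integrable P (\<lambda>\<omega>. (X \<omega> - m)\<^sup>2)"
    using assms(2) unfolding gaussian_rv_def
  proof (elim conjE disjE exE)
    fix m assume "AE \<omega> in P. X \<omega> = m"
    then have "integrable P (\<lambda>\<omega>. (X \<omega> - m)\<^sup>2) \<longleftrightarrow> integrable P (\<lambda>\<omega>. 0::real)"
      by (intro integrable_cong_AE) auto
    then show ?thesis by auto
  next
    fix m \<sigma> :: real assume s: "\<sigma> > 0" and d: "distributed P lborel X (normal_density m \<sigma>)"
    have "integrable P (\<lambda>\<omega>. (X \<omega> - m)\<^sup>2)"
      using integrable_normal_moment[OF s, of m 2] distributed_integrable[OF d, of "\<lambda>x. (x - m)\<^sup>2"]
      by simp
    then show ?thesis by blast
  qed
  then obtain m where m: "integrable P (\<lambda>\<omega>. (X \<omega> - m)\<^sup>2)" by blast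
  then have "integrable P (\<lambda>\<omega>. X \<omega> - m)"
    by (rule square_integrable_imp_integrable[rotated]) simp
  from Bochner_Integration.integrable_add[OF this, of "\<lambda>_. m"]
  show i: "integrable P X" by simp
  have "(\<lambda>\<omega>. (X \<omega>)\<^sup>2) = (\<lambda>\<omega>. (X \<omega> - m)\<^sup>2 + (2 * m * X \<omega> - m\<^sup>2))"
    by (auto simp: power2_eq_square algebra_simps)
  with m i show "integrable P (\<lambda>\<omega>. (X \<omega>)\<^sup>2)"
    by (simp only:) simp
qed

text \<open>
  A centered Gaussian law is determined by its variance, so a bound on second moments turns into
  a bound on moments of any order. Point masses fit into the formula: both sides vanish unless the
  exponent is 0.
\<close>
lemma centered_gaussian_even_moment:
  assumes "prob_space P" "gaussian_rv P X" "integral\<^sup>L P X = 0"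
  shows "integrable P (\<lambda>\<omega>. X \<omega> ^ (2 * m))"
    and "integral\<^sup>L P (\<lambda>\<omega>. X \<omega> ^ (2 * m)) =
      fact (2 * m) / (2 ^ m * fact m) * (integral\<^sup>L P (\<lambda>\<omega>. (X \<omega>)\<^sup>2)) ^ m"
proof -
  interpret prob_space P by fact
  have meas[measurable]: "X \<in> borel_measurable P"
    using assms(2) by (auto simp: gaussian_rv_def)
  have "integrable P (\<lambda>\<omega>. X \<omega> ^ (2 * m)) \<and> integral\<^sup>L P (\<lambda>\<omega>. X \<omega> ^ (2 * m)) =
      fact (2 * m) / (2 ^ m * fact m) * (integral\<^sup>L P (\<lambda>\<omega>. (X \<omega>)\<^sup>2)) ^ m"
    using assms(2) unfolding gaussian_rv_def
  proof (elim conjE disjE exE)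
    fix c assume c: "AE \<omega> in P. X \<omega> = c"
    then have "integral\<^sup>L P X = integral\<^sup>L P (\<lambda>_. c)"
      by (intro integral_cong_AE) auto
    then have "c = 0" using assms(3) by (simp add: prob_space)
    with c have ae: "AE \<omega> in P. X \<omega> = 0" by simp
    have pow: "integrable P (\<lambda>\<omega>. X \<omega> ^ k) \<and> integral\<^sup>L P (\<lambda>\<omega>. X \<omega> ^ k) = 0 ^ k" for k
    proof -
      have *: "AE \<omega> in P. X \<omega> ^ k = 0 ^ k" using ae by auto
      have "integrable P (\<lambda>\<omega>. X \<omega> ^ k) \<longleftrightarrow> integrable P (\<lambda>\<omega>. 0 ^ k :: real)"
        using * by (intro integrable_cong_AE) auto
      moreover have "integral\<^sup>L P (\<lambda>\<omega>. X \<omega> ^ k) = integral\<^sup>L P (\<lambda>\<omega>. 0 ^ k :: real)"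
        using * by (intro integral_cong_AE) auto
      ultimately show ?thesis by (simp add: prob_space)
    qed
    show ?thesis using pow[of "2 * m"] pow[of 2] by (cases m) auto
  next
    fix \<nu> \<sigma> :: real assume s: "\<sigma> > 0" and d: "distributed P lborel X (normal_density \<nu> \<sigma>)"
    have "integral\<^sup>L P X = \<nu>"
      using normal_distributed_expectation[OF s d] .
    then have "\<nu> = 0" using assms(3) by simp
    note d = d[unfolded this]
    have i: "integrable P (\<lambda>\<omega>. X \<omega> ^ k)" for k
      using integrable_normal_moment[OF s, of 0 k] distributed_integrable[OF d, of "\<lambda>x. x ^ k"]
      by simp
    have e: "integral\<^sup>L P (\<lambda>\<omega>. X \<omega> ^ (2 * k)) = fact (2 * k) / ((2 / \<sigma>\<^sup>2)^k * fact k)" for k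
      using integral_normal_moment_even[OF s, of 0 k]
        distributed_integral[OF d, of "\<lambda>x. x ^ (2 * k)"] by simp
    show ?thesis using i e[of m] e[of 1] s by (simp add: power_divide fact_2)
  qed
  then show "integrable P (\<lambda>\<omega>. X \<omega> ^ (2 * m))"
    and "integral\<^sup>L P (\<lambda>\<omega>. X \<omega> ^ (2 * m)) =
      fact (2 * m) / (2 ^ m * fact m) * (integral\<^sup>L P (\<lambda>\<omega>. (X \<omega>)\<^sup>2)) ^ m" by auto
qed

text \<open>
  The indices of a family of times may repeat, as consecutive increments share an endpoint;
  collecting the coefficients of equal times gives a combination over a set of times.
\<close>
lemma gaussian_process_linear_combination:
  assumes Z: "gaussian_process P T Z" and "finite I" "s ` I \<subseteq> T"
  shows "gaussian_rv P (\<lambda>\<omega>. \<Sum>i\<in>I. c i * Z (s i) \<omega>)"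
proof -
  have "(\<Sum>i\<in>I. c i * Z (s i) \<omega>) = (\<Sum>t\<in>s ` I. (\<Sum>i | i \<in> I \<and> s i = t. c i) * Z t \<omega>)" for \<omega>
    by (subst sum.image_gen[OF \<open>finite I\<close>, of _ s])
      (auto intro!: sum.cong simp: sum_distrib_right)
  then show ?thesis
    using Z \<open>finite I\<close> \<open>s ` I \<subseteq> T\<close> unfolding gaussian_process_def by simp
qed

lemma gaussian_process_increments_combination:
  assumes Z: "gaussian_process P T Z" and "finite I" "s ` I \<subseteq> T" "r ` I \<subseteq> T"
  shows "gaussian_rv P (\<lambda>\<omega>. \<Sum>i\<in>I. c i * (Z (s i) \<omega> - Z (r i) \<omega>))"
proof -
  have "(\<Sum>i\<in>I. c i * (Z (s i) \<omega> - Z (r i) \<omega>)) =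
      (\<Sum>(i, e)\<in>I \<times> {True, False}. (if e then c i else - c i) * Z (if e then s i else r i) \<omega>)" for \<omega>
    by (subst sum.cartesian_product[symmetric]) (simp add: algebra_simps sum.distrib)
  moreover have "gaussian_rv P (\<lambda>\<omega>. \<Sum>ie\<in>I \<times> {True, False}.
      (if snd ie then c (fst ie) else - c (fst ie)) *
      Z (if snd ie then s (fst ie) else r (fst ie)) \<omega>)"
    using assms(2-) by (intro gaussian_process_linear_combination[OF Z]) (auto simp: image_subset_iff)
  ultimately show ?thesis by (simp add: case_prod_unfold)
qed

section \<open>Moments of combinations of noise increments\<close>

text \<open>
  This is Schur's test: the spectral norm of a symmetric matrix is at most its largest absolute
  row sum, because \<open>\<bar>c i * c j\<bar>\<close> is at most the mean of the two squares. It turns the row sum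
  condition on the covariances of the increments into a bound on variances.
\<close>
lemma sum_squares_le_row_sums:
  fixes R :: "'i \<Rightarrow> 'i \<Rightarrow> real"
  assumes "finite I" and sym: "\<And>i j. R i j = R j i"
    and row: "\<And>i. i \<in> I \<Longrightarrow> (\<Sum>j\<in>I. \<bar>R i j\<bar>) \<le> B"
  shows "(\<Sum>i\<in>I. \<Sum>j\<in>I. c i * c j * R i j) \<le> B * (\<Sum>i\<in>I. (c i)\<^sup>2)"
proof -
  have "(\<Sum>i\<in>I. \<Sum>j\<in>I. c i * c j * R i j)
      \<le> (\<Sum>i\<in>I. \<Sum>j\<in>I. (c i)\<^sup>2 / 2 * \<bar>R i j\<bar> + (c j)\<^sup>2 / 2 * \<bar>R i j\<bar>)"
  proof (intro sum_mono)
    fix i j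
    have "c i * c j * R i j \<le> \<bar>c i * c j\<bar> * \<bar>R i j\<bar>"
      by (metis abs_ge_self abs_mult)
    also have "\<bar>c i * c j\<bar> \<le> (c i)\<^sup>2 / 2 + (c j)\<^sup>2 / 2"
      using sum_squares_bound[of "\<bar>c i\<bar>" "\<bar>c j\<bar>"] by (simp add: abs_mult)
    then have "\<bar>c i * c j\<bar> * \<bar>R i j\<bar> \<le> ((c i)\<^sup>2 / 2 + (c j)\<^sup>2 / 2) * \<bar>R i j\<bar>"
      by (intro mult_right_mono) auto
    finally show "c i * c j * R i j \<le> (c i)\<^sup>2 / 2 * \<bar>R i j\<bar> + (c j)\<^sup>2 / 2 * \<bar>R i j\<bar>"
      by (simp add: algebra_simps)
  qed
  also have "\<dots> = (\<Sum>i\<in>I. \<Sum>j\<in>I. (c i)\<^sup>2 / 2 * \<bar>R i j\<bar>) + (\<Sum>i\<in>I. \<Sum>j\<in>I. (c j)\<^sup>2 / 2 * \<bar>R i j\<bar>)"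
    by (simp add: sum.distrib)
  also have "(\<Sum>i\<in>I. \<Sum>j\<in>I. (c j)\<^sup>2 / 2 * \<bar>R i j\<bar>) = (\<Sum>i\<in>I. \<Sum>j\<in>I. (c i)\<^sup>2 / 2 * \<bar>R i j\<bar>)"
    by (subst sum.swap) (simp add: sym)
  also have "(\<Sum>i\<in>I. \<Sum>j\<in>I. (c i)\<^sup>2 / 2 * \<bar>R i j\<bar>) + \<dots> = (\<Sum>i\<in>I. (c i)\<^sup>2 * (\<Sum>j\<in>I. \<bar>R i j\<bar>))"
    by (simp add: sum.distrib[symmetric] sum_distrib_left mult.commute)
  also have "\<dots> \<le> (\<Sum>i\<in>I. (c i)\<^sup>2 * B)"
    using row by (intro sum_mono mult_left_mono) auto
  finally show ?thesis by (simp add: sum_distrib_left mult.commute)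
qed

lemma expectation_square_linear_combination:
  fixes W :: "'i \<Rightarrow> 'a \<Rightarrow> real"
  assumes "finite I" and meas: "\<And>i. i \<in> I \<Longrightarrow> W i \<in> borel_measurable P"
    and sq: "\<And>i. i \<in> I \<Longrightarrow> integrable P (\<lambda>\<omega>. (W i \<omega>)\<^sup>2)"
  shows "integral\<^sup>L P (\<lambda>\<omega>. (\<Sum>i\<in>I. c i * W i \<omega>)\<^sup>2) =
    (\<Sum>i\<in>I. \<Sum>j\<in>I. c i * c j * integral\<^sup>L P (\<lambda>\<omega>. W i \<omega> * W j \<omega>))"
proof -
  have int: "integrable P (\<lambda>\<omega>. W i \<omega> * W j \<omega>)" if "i \<in> I" "j \<in> I" for i j
  proof (rule Bochner_Integration.integrable_bound)
    show "integrable P (\<lambda>\<omega>. (W i \<omega>)\<^sup>2 + (W j \<omega>)\<^sup>2)" using sq that by auto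
    show "(\<lambda>\<omega>. W i \<omega> * W j \<omega>) \<in> borel_measurable P" using meas that by auto
    have "\<bar>x * y\<bar> \<le> x\<^sup>2 + y\<^sup>2" for x y :: real
      using sum_squares_bound[of "\<bar>x\<bar>" "\<bar>y\<bar>"] zero_le_power2[of x] zero_le_power2[of y]
      unfolding abs_mult power2_abs by linarith
    then show "AE \<omega> in P. norm (W i \<omega> * W j \<omega>) \<le> norm ((W i \<omega>)\<^sup>2 + (W j \<omega>)\<^sup>2)" by simp
  qed
  have "(\<Sum>i\<in>I. c i * W i \<omega>)\<^sup>2 = (\<Sum>i\<in>I. \<Sum>j\<in>I. (c i * c j) * (W i \<omega> * W j \<omega>))" for \<omega>
    by (simp add: power2_eq_square sum_product algebra_simps)
  then have "integral\<^sup>L P (\<lambda>\<omega>. (\<Sum>i\<in>I. c i * W i \<omega>)\<^sup>2) =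
      integral\<^sup>L P (\<lambda>\<omega>. \<Sum>i\<in>I. \<Sum>j\<in>I. (c i * c j) * (W i \<omega> * W j \<omega>))" by simp
  also have "\<dots> = (\<Sum>i\<in>I. integral\<^sup>L P (\<lambda>\<omega>. \<Sum>j\<in>I. (c i * c j) * (W i \<omega> * W j \<omega>)))"
    by (intro Bochner_Integration.integral_sum Bochner_Integration.integrable_sum
        Bochner_Integration.integrable_mult_right int) auto
  also have "\<dots> = (\<Sum>i\<in>I. \<Sum>j\<in>I. integral\<^sup>L P (\<lambda>\<omega>. (c i * c j) * (W i \<omega> * W j \<omega>)))"
    by (intro sum.cong refl Bochner_Integration.integral_sum
        Bochner_Integration.integrable_mult_right int) auto
  finally show ?thesis by simp
qed

lemma stationary_gaussian_increment:
  assumes "prob_space P" and Z: "centered_stationary_gaussian_process P K Z" and "h n \<ge> 0"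
  shows "gaussian_rv P (increment h Z n i)" and "integral\<^sup>L P (increment h Z n i) = 0"
proof -
  let ?t = "tgrid h n i" and ?s = "tgrid h n (i - 1)"
  have nonneg: "?t \<ge> 0" "?s \<ge> 0" using \<open>h n \<ge> 0\<close> by (auto simp: tgrid_def)
  have gp: "gaussian_process P {0..} Z" and mean: "\<And>t. t \<ge> 0 \<Longrightarrow> integral\<^sup>L P (Z t) = 0"
    using Z by (auto simp: centered_stationary_gaussian_process_def)
  have "gaussian_rv P (\<lambda>\<omega>. \<Sum>j\<in>{i}. 1 * (Z (tgrid h n j) \<omega> - Z (tgrid h n (j - 1)) \<omega>))"
    using nonneg by (intro gaussian_process_increments_combination[OF gp]) auto
  then show "gaussian_rv P (increment h Z n i)" by (simp add: increment_def[abs_def])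
  have "integrable P (Z t)" if "t \<ge> 0" for t
  proof -
    have "gaussian_rv P (\<lambda>\<omega>. \<Sum>u\<in>{t}. 1 * Z (id u) \<omega>)"
      using that by (intro gaussian_process_linear_combination[OF gp]) auto
    then show ?thesis using gaussian_rv_integrable_square(1)[OF \<open>prob_space P\<close>] by simp
  qed
  then show "integral\<^sup>L P (increment h Z n i) = 0"
    using nonneg mean by (simp add: increment_def[abs_def])
qed

text \<open>
  The combination is Gaussian, so its moments of even order are governed by its variance, and the
  variance is the quadratic form of the covariance matrix.
\<close>
lemma increments_combination_moment:
  fixes c :: "nat \<Rightarrow> real"
  assumes "prob_space P" and Z: "centered_stationary_gaussian_process P K Z" and "h n \<ge> 0"
    and row: "\<And>i. i \<in> {1..n} \<Longrightarrow>
      (\<Sum>j=1..n. \<bar>covariance P (increment h Z n i) (increment h Z n j)\<bar>) \<le> B"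
  defines "X \<equiv> \<lambda>\<omega>. \<Sum>i=1..n. c i * increment h Z n i \<omega>"
  shows "integrable P (\<lambda>\<omega>. X \<omega> ^ (2 * m))"
    and "integral\<^sup>L P (\<lambda>\<omega>. X \<omega> ^ (2 * m))
      \<le> fact (2 * m) / (2 ^ m * fact m) * (B * (\<Sum>i=1..n. (c i)\<^sup>2)) ^ m"
proof -
  let ?W = "increment h Z n"
  note W = stationary_gaussian_increment[where h = h and n = n, OF assms(1-3)]
  have meas: "?W i \<in> borel_measurable P" for i using W(1)[of i] by (simp add: gaussian_rv_def)
  note sq = gaussian_rv_integrable_square[OF \<open>prob_space P\<close> W(1)]
  have gp: "gaussian_process P {0..} Z"
    using Z by (auto simp: centered_stationary_gaussian_process_def)
  have gX: "gaussian_rv P X"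
    unfolding X_def increment_def
    using \<open>h n \<ge> 0\<close> by (intro gaussian_process_increments_combination[OF gp]) (auto simp: tgrid_def)
  have mX: "integral\<^sup>L P X = 0" unfolding X_def using sq(1) W(2) by simp
  show "integrable P (\<lambda>\<omega>. X \<omega> ^ (2 * m))"
    using centered_gaussian_even_moment(1)[OF \<open>prob_space P\<close> gX mX] .
  have "integral\<^sup>L P (\<lambda>\<omega>. (X \<omega>)\<^sup>2) =
      (\<Sum>i=1..n. \<Sum>j=1..n. c i * c j * integral\<^sup>L P (\<lambda>\<omega>. ?W i \<omega> * ?W j \<omega>))"
    unfolding X_def using meas sq(2) by (intro expectation_square_linear_combination) auto
  also have "\<dots> = (\<Sum>i=1..n. \<Sum>j=1..n. c i * c j * covariance P (?W i) (?W j))"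
    by (simp add: covariance_def W(2))
  also have "\<dots> \<le> B * (\<Sum>i=1..n. (c i)\<^sup>2)"
    using row by (intro sum_squares_le_row_sums) (auto simp: covariance_def mult.commute)
  finally have "integral\<^sup>L P (\<lambda>\<omega>. (X \<omega>)\<^sup>2) \<le> B * (\<Sum>i=1..n. (c i)\<^sup>2)" .
  then show "integral\<^sup>L P (\<lambda>\<omega>. X \<omega> ^ (2 * m))
      \<le> fact (2 * m) / (2 ^ m * fact m) * (B * (\<Sum>i=1..n. (c i)\<^sup>2)) ^ m"
    unfolding centered_gaussian_even_moment(2)[OF \<open>prob_space P\<close> gX mX]
    by (intro mult_left_mono power_mono) auto
qed

section \<open>Chaining\<close>

text \<open>
  A net of scale \<open>4 ^ - k\<close> picks one point of the set in every occupied cell of the lattice of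
  mesh \<open>4 ^ - k\<close>. Level 0 is instead the single point \<open>x0\<close>: a process that vanishes there is then
  the sum of its links along a chain, without an initial term.
\<close>
lemma bounded_imp_geometric_nets:
  fixes S :: "'b::euclidean_space set"
  assumes "bounded S" "x0 \<in> S"
  obtains A D :: real and \<pi> :: "nat \<Rightarrow> 'b \<Rightarrow> 'b" where
    "D > 0" "\<And>x. \<pi> 0 x = x0"
    "\<And>k x. x \<in> S \<Longrightarrow> \<pi> k x \<in> S" "\<And>k x. x \<in> S \<Longrightarrow> dist x (\<pi> k x) \<le> D / 4 ^ k"
    "\<And>k. finite (\<pi> k ` S)" "\<And>k. real (card (\<pi> k ` S)) \<le> A * (4 ^ k) ^ DIM('b)"
proof -
  obtain R0 where R0: "\<And>x. x \<in> S \<Longrightarrow> norm x \<le> R0"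
    using assms(1) by (auto simp: bounded_iff)
  define R :: nat where "R = nat \<lceil>\<bar>R0\<bar>\<rceil>"
  have R: "norm x \<le> R" if "x \<in> S" for x
    using R0[OF that] unfolding R_def by linarith
  define cell :: "nat \<Rightarrow> 'b \<Rightarrow> 'b \<Rightarrow> int"
    where "cell k x = restrict (\<lambda>i. \<lfloor>4 ^ k * (x \<bullet> i)\<rfloor>) Basis" for k x
  define \<rho> where "\<rho> k x = (SOME y. y \<in> S \<and> cell k y = cell k x)" for k x
  have \<rho>: "\<rho> k x \<in> S \<and> cell k (\<rho> k x) = cell k x" if "x \<in> S" for k x
    unfolding \<rho>_def using that by (intro someI[of "\<lambda>y. y \<in> S \<and> cell k y = cell k x"]) auto
  \<comment> \<open>Within a cell the distance is at most the sum of the coordinate differences, hence the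
    summand \<^term>\<open>DIM('b)\<close>; the summand \<^term>\<open>2 * R\<close> covers level 0, where the
    net is reduced to the base point.\<close>
  define D :: real where "D = 2 * R + DIM('b)"
  define A :: real where "A = (2 * R + 1) ^ DIM('b)"
  define \<pi> where "\<pi> k x = (if k = 0 then x0 else \<rho> k x)" for k x
  have cell_mem: "cell k x \<in> (\<Pi>\<^sub>E i\<in>Basis. {- (int R * 4 ^ k)..int R * 4 ^ k})" if "x \<in> S" for k x
  proof -
    have "- (int R * 4 ^ k) \<le> \<lfloor>4 ^ k * (x \<bullet> i)\<rfloor> \<and> \<lfloor>4 ^ k * (x \<bullet> i)\<rfloor> \<le> int R * 4 ^ k"
      if "i \<in> Basis" for i
    proof -
      have "\<bar>x \<bullet> i\<bar> \<le> R"
        using Basis_le_norm[OF that, of x] R[OF \<open>x \<in> S\<close>] by linarith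
      then have "\<bar>4 ^ k * (x \<bullet> i)\<bar> \<le> R * 4 ^ k"
        by (simp add: abs_mult mult.commute)
      then have "real_of_int (- (int R * 4 ^ k)) \<le> 4 ^ k * (x \<bullet> i)"
        and "4 ^ k * (x \<bullet> i) \<le> real_of_int (int R * 4 ^ k)"
        unfolding abs_le_iff by (simp_all only: of_int_minus of_int_mult of_int_power of_int_numeral
            of_int_of_nat_eq of_nat_mult of_nat_power of_nat_numeral minus_le_iff)
      then show ?thesis
        by (metis le_floor_iff floor_mono floor_of_int)
    qed
    then show ?thesis by (auto simp: cell_def)
  qed
  have fin: "finite (\<Pi>\<^sub>E i\<in>(Basis::'b set). {- (int R * 4 ^ k)..int R * 4 ^ k})" for k
    by (intro finite_PiE) auto
  have sub: "\<rho> k ` S \<subseteq> (\<lambda>c. SOME y. y \<in> S \<and> cell k y = c) `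
      (\<Pi>\<^sub>E i\<in>Basis. {- (int R * 4 ^ k)..int R * 4 ^ k})" for k
    using cell_mem by (auto simp: \<rho>_def)
  have fin\<rho>: "finite (\<rho> k ` S)" for k
    by (rule finite_subset[OF sub]) (intro finite_imageI fin)
  have card\<rho>: "real (card (\<rho> k ` S)) \<le> A * (4 ^ k) ^ DIM('b)" for k
  proof -
    have "card (\<rho> k ` S) \<le> card (\<Pi>\<^sub>E i\<in>(Basis::'b set). {- (int R * 4 ^ k)..int R * 4 ^ k})"
      by (rule order_trans[OF card_mono[OF _ sub]]) (auto intro!: fin card_image_le)
    also have "\<dots> = (2 * R * 4 ^ k + 1) ^ DIM('b)"
    proof -
      have "nat (2 * (int R * 4 ^ k) + 1) = 2 * R * 4 ^ k + 1"
        by (metis int_ops(2) nat_int of_nat_add of_nat_mult of_nat_numeral of_nat_power mult.assoc)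
      then show ?thesis by (simp add: card_PiE)
    qed
    also have "\<dots> \<le> ((2 * R + 1) * 4 ^ k) ^ DIM('b)"
      by (intro power_mono) (simp_all add: add_mult_distrib)
    finally have "real (card (\<rho> k ` S)) \<le> real (((2 * R + 1) * 4 ^ k) ^ DIM('b))"
      by (simp only: of_nat_le_iff)
    then show ?thesis
      by (simp only: A_def power_mult_distrib of_nat_mult of_nat_power of_nat_numeral)
  qed
  have floor_close: "\<bar>b - a\<bar> \<le> 1" if "\<lfloor>a\<rfloor> = \<lfloor>b\<rfloor>" for a b :: real
    using that by linarith
  have dist\<rho>: "dist x (\<rho> k x) \<le> DIM('b) / 4 ^ k" if "x \<in> S" for k x
  proof -
    have "\<bar>(x - \<rho> k x) \<bullet> i\<bar> \<le> 1 / 4 ^ k" if "i \<in> Basis" for i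
    proof -
      have "cell k (\<rho> k x) i = cell k x i" using \<rho>[OF \<open>x \<in> S\<close>] by simp
      then have "\<lfloor>4 ^ k * (\<rho> k x \<bullet> i)\<rfloor> = \<lfloor>4 ^ k * (x \<bullet> i)\<rfloor>"
        using that by (simp add: cell_def)
      then have "\<bar>4 ^ k * (x \<bullet> i) - 4 ^ k * (\<rho> k x \<bullet> i)\<bar> \<le> 1"
        by (rule floor_close)
      then have "4 ^ k * \<bar>(x - \<rho> k x) \<bullet> i\<bar> \<le> 1"
        by (simp add: inner_diff_left right_diff_distrib[symmetric] abs_mult)
      then show ?thesis by (simp add: field_simps)
    qed
    then have "(\<Sum>i\<in>Basis. \<bar>(x - \<rho> k x) \<bullet> i\<bar>) \<le> (\<Sum>i\<in>(Basis::'b set). 1 / 4 ^ k)"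
      by (intro sum_mono)
    then show ?thesis
      using norm_le_l1[of "x - \<rho> k x"] by (simp add: dist_norm)
  qed
  show thesis
  proof (rule that)
    show "D > 0" by (auto simp: D_def add_nonneg_pos)
    show "\<pi> 0 x = x0" for x by (simp add: \<pi>_def)
    show "\<pi> k x \<in> S" if "x \<in> S" for k x using \<rho>[OF that] assms(2) by (simp add: \<pi>_def)
    show "dist x (\<pi> k x) \<le> D / 4 ^ k" if "x \<in> S" for k x
    proof (cases "k = 0")
      case True
      have "dist x x0 \<le> norm x + norm x0" by (simp add: dist_norm norm_triangle_ineq4)
      with True R[OF that] R[OF assms(2)] show ?thesis by (simp add: \<pi>_def D_def)
    next
      case False
      have "DIM('b) / 4 ^ k \<le> D / 4 ^ k" by (intro divide_right_mono) (auto simp: D_def)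
      with False dist\<rho>[OF that, of k] show ?thesis by (simp add: \<pi>_def)
    qed
    show "finite (\<pi> k ` S)" for k
    proof (cases "k = 0")
      case True then show ?thesis
        by (intro finite_subset[of "\<pi> k ` S" "{x0}"]) (auto simp: \<pi>_def)
    next
      case False
      then have "\<pi> k ` S = \<rho> k ` S" by (auto simp: \<pi>_def)
      then show ?thesis using fin\<rho> by (simp only:)
    qed
    show "real (card (\<pi> k ` S)) \<le> A * (4 ^ k) ^ DIM('b)" for k
    proof (cases "k = 0")
      case True
      then have "\<pi> k ` S = {x0}" using assms(2) by (auto simp: \<pi>_def)
      moreover have "1 \<le> A" by (simp add: A_def)
      ultimately show ?thesis using True by simp
    next
      case False
      then have "\<pi> k ` S = \<rho> k ` S" by (auto simp: \<pi>_def)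
      then show ?thesis using card\<rho>[of k] by (simp only:)
    qed
  qed
qed

text \<open>
  A point is joined to \<open>x0\<close> by its projections onto finer and finer nets, and continuity makes
  the process at the point the sum of the links. If the links of level \<open>k\<close> are at most
  \<open>\<delta> / 2 ^ k\<close>, the sum is at most \<open>2 * \<delta>\<close>. By Markov's inequality a link of length
  \<open>4 ^ - k\<close> exceeds its share with a probability of order \<open>2 ^ (- k * q)\<close>, and there are of order
  \<open>2 ^ (4 * d * k)\<close> links, so the failure probabilities are summable as soon as \<open>q > 4 * d\<close>; the
  value \<open>4 * d + 2\<close> is moreover even. An exceptional event is produced instead of a bound on the
  supremum, which avoids the question whether the supremum is measurable.
\<close>
lemma chaining_maximal_inequality:
  fixes S :: "'b::metric_space set" and G :: "'b \<Rightarrow> 'a \<Rightarrow> real"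
    and A D L \<delta> :: real and d :: nat
  defines "q \<equiv> 4 * d + 2"
  assumes "prob_space P" and "D > 0"
    and \<pi>_0: "\<And>x. \<pi> 0 x = x0" and \<pi>_mem: "\<And>k x. x \<in> S \<Longrightarrow> \<pi> k x \<in> S"
    and \<pi>_dist: "\<And>k x. x \<in> S \<Longrightarrow> dist x (\<pi> k x) \<le> D / 4 ^ k"
    and \<pi>_finite: "\<And>k. finite (\<pi> k ` S)"
    and \<pi>_card: "\<And>k. real (card (\<pi> k ` S)) \<le> A * (4 ^ k) ^ d"
    and measurable: "\<And>x. x \<in> S \<Longrightarrow> G x \<in> borel_measurable P"
    and continuous: "\<And>\<omega>. \<omega> \<in> space P \<Longrightarrow> continuous_on S (\<lambda>x. G x \<omega>)"
    and zero: "\<And>\<omega>. \<omega> \<in> space P \<Longrightarrow> G x0 \<omega> = 0"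
    and integrable: "\<And>u v. u \<in> S \<Longrightarrow> v \<in> S \<Longrightarrow> integrable P (\<lambda>\<omega>. (G u \<omega> - G v \<omega>) ^ q)"
    and moment: "\<And>u v. u \<in> S \<Longrightarrow> v \<in> S \<Longrightarrow>
      integral\<^sup>L P (\<lambda>\<omega>. (G u \<omega> - G v \<omega>) ^ q) \<le> L * dist u v ^ q"
    and "L \<ge> 0" "\<delta> > 0"
  obtains B where "B \<in> sets P"
    and "measure P B \<le> 4 / 3 * (A\<^sup>2 * 4 ^ d * (2 * D) ^ q) * L / \<delta> ^ q"
    and "\<And>\<omega> x. \<omega> \<in> space P \<Longrightarrow> \<omega> \<notin> B \<Longrightarrow> x \<in> S \<Longrightarrow> \<bar>G x \<omega>\<bar> \<le> 2 * \<delta>"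
proof -
  interpret prob_space P by fact
  define E where "E k = (\<lambda>x. (\<pi> (Suc k) x, \<pi> k x)) ` S" for k
  \<comment> \<open>The links of all chains between two consecutive levels are finitely many pairs; a level is
    bad if one of its links is longer than the share \<^term>\<open>\<delta> / 2 ^ k\<close> of the error.\<close>
  define B where "B k = (\<Union>(u, v)\<in>E k. {\<omega> \<in> space P. \<delta> / 2 ^ k \<le> \<bar>G u \<omega> - G v \<omega>\<bar>})" for k
  define c where "c = A\<^sup>2 * 4 ^ d * (2 * D) ^ q * L / \<delta> ^ q"
  have E_sub: "E k \<subseteq> \<pi> (Suc k) ` S \<times> \<pi> k ` S" for k by (auto simp: E_def)
  have E_fin: "finite (E k)" for k
    by (rule finite_subset[OF E_sub]) (intro finite_cartesian_product \<pi>_finite)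
  have E_card: "real (card (E k)) \<le> A\<^sup>2 * 4 ^ d * (16 ^ d) ^ k" for k
  proof -
    have "card (E k) \<le> card (\<pi> (Suc k) ` S) * card (\<pi> k ` S)"
      using card_mono[OF _ E_sub[of k]] \<pi>_finite by (simp add: card_cartesian_product)
    then have "real (card (E k)) \<le> real (card (\<pi> (Suc k) ` S)) * real (card (\<pi> k ` S))"
      by (metis of_nat_le_iff of_nat_mult)
    also have "\<dots> \<le> (A * (4 ^ Suc k) ^ d) * (A * (4 ^ k) ^ d)"
      by (intro mult_mono \<pi>_card order_trans[OF of_nat_0_le_iff \<pi>_card] of_nat_0_le_iff)
    also have "\<dots> = A\<^sup>2 * 4 ^ d * ((4 ^ k) ^ d * (4 ^ k) ^ d)"
      by (simp add: power2_eq_square power_mult_distrib)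
    also have "(4 ^ k) ^ d * (4 ^ k) ^ d = ((16::real) ^ d) ^ k"
      by (simp add: power_mult_distrib[symmetric] power_mult[symmetric] mult.commute)
    finally show ?thesis .
  qed
  have E_mem: "u \<in> S" "v \<in> S" "dist u v \<le> 2 * D / 4 ^ k" if "(u, v) \<in> E k" for u v k
  proof -
    from that obtain x where x: "x \<in> S" "u = \<pi> (Suc k) x" "v = \<pi> k x" by (auto simp: E_def)
    show "u \<in> S" "v \<in> S" using x \<pi>_mem by auto
    have "dist u v \<le> dist x u + dist x v" by (rule dist_triangle3)
    also have "\<dots> \<le> D / 4 ^ Suc k + D / 4 ^ k" unfolding x by (intro add_mono \<pi>_dist x)
    also have "\<dots> \<le> 2 * D / 4 ^ k" using \<open>D > 0\<close> by (simp add: field_simps)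
    finally show "dist u v \<le> 2 * D / 4 ^ k" .
  qed
  have pair_sets: "{\<omega> \<in> space P. \<delta> / 2 ^ k \<le> \<bar>G u \<omega> - G v \<omega>\<bar>} \<in> sets P"
    if "(u, v) \<in> E k" for u v k
    using measurable[OF E_mem(1)[OF that]] measurable[OF E_mem(2)[OF that]] by measurable
  have B_sets: "B k \<in> sets P" for k
    unfolding B_def using E_fin pair_sets by (intro sets.finite_UN) auto
  have even_q: "even q" by (simp add: q_def)
  have pair_prob: "prob {\<omega> \<in> space P. \<delta> / 2 ^ k \<le> \<bar>G u \<omega> - G v \<omega>\<bar>}
      \<le> L * (2 * D) ^ q / \<delta> ^ q / (2 ^ q) ^ k" if "(u, v) \<in> E k" for u v k
  proof -
    have [measurable]: "G u \<in> borel_measurable P" "G v \<in> borel_measurable P"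
      using measurable E_mem[OF that] by auto
    have "prob {\<omega> \<in> space P. \<delta> / 2 ^ k \<le> \<bar>G u \<omega> - G v \<omega>\<bar>}
        \<le> prob {\<omega> \<in> space P. (\<delta> / 2 ^ k) ^ q \<le> (G u \<omega> - G v \<omega>) ^ q}"
    proof (intro finite_measure_mono subsetI)
      fix \<omega> assume "\<omega> \<in> {\<omega> \<in> space P. \<delta> / 2 ^ k \<le> \<bar>G u \<omega> - G v \<omega>\<bar>}"
      then have "\<omega> \<in> space P" "(\<delta> / 2 ^ k) ^ q \<le> \<bar>G u \<omega> - G v \<omega>\<bar> ^ q"
        using \<open>\<delta> > 0\<close> by (auto intro!: power_mono)
      then show "\<omega> \<in> {\<omega> \<in> space P. (\<delta> / 2 ^ k) ^ q \<le> (G u \<omega> - G v \<omega>) ^ q}"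
        using even_q by (simp add: power_even_abs)
    qed measurable
    also have "\<dots> \<le> (\<integral>\<omega>. (G u \<omega> - G v \<omega>) ^ q \<partial>P) / (\<delta> / 2 ^ k) ^ q"
    proof (rule integral_Markov_inequality_measure[where A = "{}"])
      show "integrable P (\<lambda>\<omega>. (G u \<omega> - G v \<omega>) ^ q)" using integrable E_mem[OF that] by auto
      show "0 < (\<delta> / 2 ^ k) ^ q" using \<open>\<delta> > 0\<close> by simp
    qed (use even_q in \<open>auto simp: zero_le_even_power\<close>)
    also have "\<dots> \<le> (L * (2 * D / 4 ^ k) ^ q) / (\<delta> / 2 ^ k) ^ q"
    proof (rule divide_right_mono)
      have "(\<integral>\<omega>. (G u \<omega> - G v \<omega>) ^ q \<partial>P) \<le> L * dist u v ^ q" using moment E_mem[OF that] by auto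
      also have "\<dots> \<le> L * (2 * D / 4 ^ k) ^ q"
        using \<open>L \<ge> 0\<close> E_mem(3)[OF that] by (intro mult_left_mono power_mono) auto
      finally show "(\<integral>\<omega>. (G u \<omega> - G v \<omega>) ^ q \<partial>P) \<le> L * (2 * D / 4 ^ k) ^ q" .
    qed (use \<open>\<delta> > 0\<close> in simp)
    also have "\<dots> = L * ((2 * D) * (2 ^ k / 4 ^ k) / \<delta>) ^ q"
      by (simp add: power_mult_distrib power_divide)
    also have "(2::real) ^ k / 4 ^ k = 1 / 2 ^ k"
      by (simp add: power_divide[symmetric] power_one_over)
    also have "L * ((2 * D) * (1 / 2 ^ k) / \<delta>) ^ q = L * (2 * D) ^ q / \<delta> ^ q / (2 ^ k) ^ q"
      by (simp add: power_mult_distrib power_divide field_simps)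
    also have "((2::real) ^ k) ^ q = (2 ^ q) ^ k" by (simp add: power_mult[symmetric] mult.commute)
    finally show ?thesis .
  qed
  have B_prob: "prob (B k) \<le> c * (1 / 4) ^ k" for k
  proof -
    have "prob (B k) \<le> (\<Sum>(u, v)\<in>E k. prob {\<omega> \<in> space P. \<delta> / 2 ^ k \<le> \<bar>G u \<omega> - G v \<omega>\<bar>})"
      unfolding B_def case_prod_unfold using E_fin pair_sets by (intro measure_UNION_le) auto
    also have "\<dots> \<le> (\<Sum>e\<in>E k. L * (2 * D) ^ q / \<delta> ^ q / (2 ^ q) ^ k)"
      using pair_prob by (intro sum_mono) auto
    also have "\<dots> = real (card (E k)) * (L * (2 * D) ^ q / \<delta> ^ q / (2 ^ q) ^ k)" by simp
    also have "\<dots> \<le> (A\<^sup>2 * 4 ^ d * (16 ^ d) ^ k) * (L * (2 * D) ^ q / \<delta> ^ q / (2 ^ q) ^ k)"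
      using E_card \<open>L \<ge> 0\<close> \<open>D > 0\<close> \<open>\<delta> > 0\<close> by (intro mult_right_mono) auto
    also have "\<dots> = c * ((16 ^ d) ^ k / (2 ^ q) ^ k)" by (simp add: c_def)
    also have "((16::real) ^ d) ^ k / (2 ^ q) ^ k = (16 ^ d / 2 ^ q) ^ k"
      by (simp add: power_divide)
    \<comment> \<open>This is where the order of the moment enters: the factor 16 per dimension counts the links
      of a level, and the exponent leaves a factor 4 to spare.\<close>
    also have "(16::real) ^ d / 2 ^ q = 1 / 4"
      by (simp add: q_def power_add power_mult)
    finally show ?thesis .
  qed
  have geo: "(\<lambda>k. c * (1 / 4) ^ k) sums (c * (4 / 3))"
    using sums_mult[OF geometric_sums[of "1 / 4 :: real"], of c] by simp
  have summable: "summable (\<lambda>k. prob (B k))"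
    by (rule summable_comparison_test'[OF sums_summable[OF geo]]) (use B_prob in auto)
  show thesis
  proof (rule that)
    show "(\<Union>k. B k) \<in> sets P" using B_sets by auto
    have "prob (\<Union>k. B k) \<le> (\<Sum>k. prob (B k))"
      using B_sets summable by (intro finite_measure_subadditive_countably) auto
    also have "\<dots> \<le> (\<Sum>k. c * (1 / 4) ^ k)"
      by (intro suminf_le B_prob summable sums_summable[OF geo])
    also have "\<dots> = c * (4 / 3)" using geo by (rule sums_unique[symmetric])
    finally show "prob (\<Union>k. B k) \<le> 4 / 3 * (A\<^sup>2 * 4 ^ d * (2 * D) ^ q) * L / \<delta> ^ q"
      by (simp add: c_def)
  next
    fix \<omega> x assume \<omega>: "\<omega> \<in> space P" "\<omega> \<notin> (\<Union>k. B k)" and x: "x \<in> S"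
    have step: "\<bar>G (\<pi> (Suc k) x) \<omega> - G (\<pi> k x) \<omega>\<bar> \<le> \<delta> / 2 ^ k" for k
    proof -
      have "(\<pi> (Suc k) x, \<pi> k x) \<in> E k" using x by (auto simp: E_def)
      moreover have "\<omega> \<notin> B k" using \<omega> by blast
      ultimately show ?thesis using \<omega>(1) by (fastforce simp: B_def)
    qed
    have bound: "\<bar>G (\<pi> k x) \<omega>\<bar> \<le> 2 * \<delta> - 2 * \<delta> / 2 ^ k" for k
    proof (induction k)
      case 0 then show ?case using zero[OF \<omega>(1)] by (simp add: \<pi>_0)
    next
      case (Suc k)
      then have "\<bar>G (\<pi> (Suc k) x) \<omega>\<bar> \<le> (2 * \<delta> - 2 * \<delta> / 2 ^ k) + \<delta> / 2 ^ k"
        using step[of k] by linarith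
      then show ?case by (simp add: field_simps)
    qed
    have "(\<lambda>k. D * (1 / 4) ^ k) \<longlonglongrightarrow> D * 0"
      by (intro tendsto_mult tendsto_const LIMSEQ_power_zero) simp
    then have decay: "(\<lambda>k. D * (1 / 4) ^ k) \<longlonglongrightarrow> 0" by simp
    have "norm (dist (\<pi> k x) x) \<le> D * (1 / 4) ^ k" for k
      using \<pi>_dist[OF x, of k] by (simp add: dist_commute power_one_over)
    then have "(\<lambda>k. dist (\<pi> k x) x) \<longlonglongrightarrow> 0"
      by (intro Lim_null_comparison[OF always_eventually decay]) simp
    then have "(\<lambda>k. \<pi> k x) \<longlonglongrightarrow> x" by (rule iffD2[OF tendsto_dist_iff])
    then have "(\<lambda>k. G (\<pi> k x) \<omega>) \<longlonglongrightarrow> G x \<omega>"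
      using continuous[OF \<omega>(1)] x \<pi>_mem[OF x] unfolding continuous_on_sequentially comp_def by auto
    then have "(\<lambda>k. \<bar>G (\<pi> k x) \<omega>\<bar>) \<longlonglongrightarrow> \<bar>G x \<omega>\<bar>" by (rule tendsto_rabs)
    then show "\<bar>G x \<omega>\<bar> \<le> 2 * \<delta>"
    proof (rule LIMSEQ_le_const2)
      have "2 * \<delta> - 2 * \<delta> / 2 ^ k \<le> 2 * \<delta>" for k using \<open>\<delta> > 0\<close> by simp
      then show "\<exists>N. \<forall>k\<ge>N. \<bar>G (\<pi> k x) \<omega>\<bar> \<le> 2 * \<delta>"
        using bound order_trans by blast
    qed
  qed
qed

text \<open>
  The nets depend on the set only, so the constant of the chaining inequality is the same for all
  members of the sequence, and the exceptional probabilities vanish along with \<open>L n\<close>.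
\<close>
lemma uniformly_small_in_probability:
  fixes S :: "'b::euclidean_space set" and G :: "nat \<Rightarrow> 'b \<Rightarrow> 'a \<Rightarrow> real" and L :: "nat \<Rightarrow> real"
  defines "q \<equiv> 4 * DIM('b) + 2"
  assumes "prob_space P" and "bounded S" "x0 \<in> S" and "L \<longlonglongrightarrow> 0"
    and measurable: "\<And>n x. x \<in> S \<Longrightarrow> n \<ge> N \<Longrightarrow> G n x \<in> borel_measurable P"
    and continuous: "\<And>n \<omega>. n \<ge> N \<Longrightarrow> \<omega> \<in> space P \<Longrightarrow> continuous_on S (\<lambda>x. G n x \<omega>)"
    and zero: "\<And>n \<omega>. n \<ge> N \<Longrightarrow> \<omega> \<in> space P \<Longrightarrow> G n x0 \<omega> = 0"
    and integrable: "\<And>n u v. n \<ge> N \<Longrightarrow> u \<in> S \<Longrightarrow> v \<in> S \<Longrightarrow>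
      integrable P (\<lambda>\<omega>. (G n u \<omega> - G n v \<omega>) ^ q)"
    and moment: "\<And>n u v. n \<ge> N \<Longrightarrow> u \<in> S \<Longrightarrow> v \<in> S \<Longrightarrow>
      integral\<^sup>L P (\<lambda>\<omega>. (G n u \<omega> - G n v \<omega>) ^ q) \<le> L n * dist u v ^ q"
    and L_nonneg: "\<And>n. n \<ge> N \<Longrightarrow> L n \<ge> 0" and "\<delta> > 0"
  obtains B F where "F \<longlonglongrightarrow> 0" and "\<And>n. n \<ge> N \<Longrightarrow> B n \<in> sets P"
    and "\<And>n. n \<ge> N \<Longrightarrow> measure P (B n) \<le> F n"
    and "\<And>n \<omega> x. n \<ge> N \<Longrightarrow> \<omega> \<in> space P \<Longrightarrow> \<omega> \<notin> B n \<Longrightarrow> x \<in> S \<Longrightarrow> \<bar>G n x \<omega>\<bar> \<le> \<delta>"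
proof -
  obtain A D :: real and \<pi> where nets: "D > 0" "\<And>x. \<pi> 0 x = x0"
    "\<And>k x. x \<in> S \<Longrightarrow> \<pi> k x \<in> S" "\<And>k x. x \<in> S \<Longrightarrow> dist x (\<pi> k x) \<le> D / 4 ^ k"
    "\<And>k. finite (\<pi> k ` S)" "\<And>k. real (card (\<pi> k ` S)) \<le> A * (4 ^ k) ^ DIM('b)"
    using bounded_imp_geometric_nets[OF \<open>bounded S\<close> \<open>x0 \<in> S\<close>] by metis
  define F where "F n = 4 / 3 * (A\<^sup>2 * 4 ^ DIM('b) * (2 * D) ^ q) * L n / (\<delta> / 2) ^ q" for n
  have "\<exists>B. B \<in> sets P \<and> measure P B \<le> F n \<and>
      (\<forall>\<omega> x. \<omega> \<in> space P \<longrightarrow> \<omega> \<notin> B \<longrightarrow> x \<in> S \<longrightarrow> \<bar>G n x \<omega>\<bar> \<le> \<delta>)" if n: "n \<ge> N" for n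
  proof -
    obtain B where "B \<in> sets P" "measure P B \<le> F n"
      "\<And>\<omega> x. \<omega> \<in> space P \<Longrightarrow> \<omega> \<notin> B \<Longrightarrow> x \<in> S \<Longrightarrow> \<bar>G n x \<omega>\<bar> \<le> 2 * (\<delta> / 2)"
      unfolding F_def q_def
      using chaining_maximal_inequality[OF \<open>prob_space P\<close> nets measurable[OF _ n]
          continuous[OF n] zero[OF n] integrable[OF n, unfolded q_def]
          moment[OF n, unfolded q_def] L_nonneg[OF n], of "\<delta> / 2"] \<open>\<delta> > 0\<close> by auto
    then show ?thesis by auto
  qed
  then obtain B where B: "\<And>n. n \<ge> N \<Longrightarrow> B n \<in> sets P \<and> measure P (B n) \<le> F n \<and>
      (\<forall>\<omega> x. \<omega> \<in> space P \<longrightarrow> \<omega> \<notin> B n \<longrightarrow> x \<in> S \<longrightarrow> \<bar>G n x \<omega>\<bar> \<le> \<delta>)"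
    by metis
  have "F \<longlonglongrightarrow> 4 / 3 * (A\<^sup>2 * 4 ^ DIM('b) * (2 * D) ^ q) * 0 / (\<delta> / 2) ^ q"
    unfolding F_def using \<open>\<delta> > 0\<close> by (intro tendsto_intros \<open>L \<longlonglongrightarrow> 0\<close>) auto
  then show thesis using that[of F B] B by simp
qed

section \<open>The drift and the least squares contrast\<close>

text \<open>
  A bounded derivative makes the integrand Lipschitz, and the error of the left endpoint rule is
  quadratic in the step.
\<close>
lemma integral_minus_left_endpoint_rule:
  fixes f :: "real \<Rightarrow> real"
  assumes deriv: "\<And>t. t \<ge> 0 \<Longrightarrow> \<exists>D. (f has_real_derivative D) (at t within {0..}) \<and> \<bar>D\<bar> \<le> C"
    and "0 \<le> s" "s \<le> t" and int: "set_integrable lborel {0..t} f"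
  shows "\<bar>(LINT u:{0..t}|lborel. f u) - (LINT u:{0..s}|lborel. f u) - f s * (t - s)\<bar> \<le> C * (t - s)\<^sup>2"
proof -
  obtain f' where f': "\<And>t. t \<ge> 0 \<Longrightarrow> (f has_real_derivative f' t) (at t within {0..})"
    "\<And>t. t \<ge> 0 \<Longrightarrow> \<bar>f' t\<bar> \<le> C"
    using deriv by metis
  have lip: "\<bar>f u - f s\<bar> \<le> C * \<bar>u - s\<bar>" if "u \<ge> 0" for u
    using field_differentiable_bound[of "{0..}" f f' C u s] f' that \<open>0 \<le> s\<close> by auto
  have "C \<ge> 0" using f'(2)[of 0] by simp
  have i1: "set_integrable lborel {0..s} f" and i2: "set_integrable lborel {s<..t} f"
    using \<open>0 \<le> s\<close> \<open>s \<le> t\<close> by (auto intro: set_integrable_subset[OF int])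
  have "{0..t} = {0..s} \<union> {s<..t}" using \<open>0 \<le> s\<close> \<open>s \<le> t\<close> by auto
  then have split: "(LINT u:{0..t}|lborel. f u) = (LINT u:{0..s}|lborel. f u) + (LINT u:{s<..t}|lborel. f u)"
    using set_integral_Un[OF _ i1 i2] by (simp add: ivl_disj_int)
  have const: "set_integrable lborel {s<..t} (\<lambda>_. c)" "(LINT u:{s<..t}|lborel. c) = c * (t - s)" for c :: real
    using \<open>s \<le> t\<close> by (auto simp: set_integrable_def set_lebesgue_integral_def)
  have close: "f s - C * (t - s) \<le> f u \<and> f u \<le> f s + C * (t - s)" if "u \<in> {s<..t}" for u
  proof -
    have "\<bar>f u - f s\<bar> \<le> C * \<bar>u - s\<bar>" using that \<open>0 \<le> s\<close> by (intro lip) auto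
    also have "\<dots> \<le> C * (t - s)" using that \<open>C \<ge> 0\<close> by (intro mult_left_mono) auto
    finally show ?thesis by linarith
  qed
  have "(LINT u:{s<..t}|lborel. f u) \<le> (f s + C * (t - s)) * (t - s)"
    using set_integral_mono[OF i2 const(1)[of "f s + C * (t - s)"]] close const(2) by auto
  moreover have "(f s - C * (t - s)) * (t - s) \<le> (LINT u:{s<..t}|lborel. f u)"
    using set_integral_mono[OF const(1)[of "f s - C * (t - s)"] i2] close const(2) by auto
  ultimately show ?thesis
    unfolding split abs_le_iff by (simp add: power2_eq_square algebra_simps)
qed

lemma has_gradient_within_bounded_imp_lipschitz:
  assumes "convex S"
    and grad: "\<And>x. x \<in> S \<Longrightarrow> \<exists>g. has_gradient_within f g x S \<and> norm g \<le> M"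
    and "x \<in> S" "y \<in> S"
  shows "\<bar>f x - f y\<bar> \<le> M * dist x y"
proof -
  obtain g where g: "\<And>x. x \<in> S \<Longrightarrow> (f has_derivative (\<lambda>v. g x \<bullet> v)) (at x within S)"
    "\<And>x. x \<in> S \<Longrightarrow> norm (g x) \<le> M"
    using grad unfolding has_gradient_within_def by metis
  have "norm (f x - f y) \<le> M * norm (x - y)"
  proof (rule differentiable_bound[OF \<open>convex S\<close> g(1)])
    fix z assume "z \<in> S"
    show "onorm (\<lambda>v. g z \<bullet> v) \<le> M"
    proof (rule onorm_le)
      fix v
      have "norm (g z \<bullet> v) \<le> norm (g z) * norm v" by (simp add: Cauchy_Schwarz_ineq2)
      also have "\<dots> \<le> M * norm v" using g(2)[OF \<open>z \<in> S\<close>] by (intro mult_right_mono) auto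
      finally show "norm (g z \<bullet> v) \<le> M * norm v" .
    qed
  qed (use assms in auto)
  then show ?thesis by (simp add: dist_norm)
qed

text \<open>
  Expanding the squares leaves \<open>\<eta>\<close> times the squared distance of the two models, a linear noise
  term and a linear bias term. The bias term is split by
  \<open>4 * \<eta> * d * r \<le> (\<eta> * d)\<^sup>2 + 4 * r\<^sup>2\<close> and half of the squared distance is absorbed, so no a priori
  bound on the fitted model is required.
\<close>
lemma least_squares_basic_inequality:
  fixes w r m m0 :: "'i \<Rightarrow> real"
  assumes "\<eta> > 0"
    and le: "(\<Sum>i\<in>I. (w i + r i + m0 i * \<eta> - m i * \<eta>)\<^sup>2) \<le> (\<Sum>i\<in>I. (w i + r i)\<^sup>2)"
    and r: "\<And>i. i \<in> I \<Longrightarrow> \<bar>r i\<bar> \<le> \<rho>"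
  shows "\<eta> * (\<Sum>i\<in>I. (m i - m0 i)\<^sup>2) \<le> 4 * (\<Sum>i\<in>I. (m i - m0 i) * w i) + 4 * real (card I) * \<rho>\<^sup>2 / \<eta>"
proof -
  have "\<eta>\<^sup>2 * (m i - m0 i)\<^sup>2 \<le> 2 * ((w i + r i + m0 i * \<eta> - m i * \<eta>)\<^sup>2 - (w i + r i)\<^sup>2)
      + 4 * \<eta> * ((m i - m0 i) * w i) + 4 * \<rho>\<^sup>2" if "i \<in> I" for i
  proof -
    have "(r i)\<^sup>2 \<le> \<rho>\<^sup>2" using r[OF that] by (metis abs_ge_zero power2_abs power_mono)
    moreover have "0 \<le> (\<eta> * (m i - m0 i) - 2 * r i)\<^sup>2" by simp
    ultimately show ?thesis by (simp add: power2_eq_square algebra_simps)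
  qed
  then have "(\<Sum>i\<in>I. \<eta>\<^sup>2 * (m i - m0 i)\<^sup>2) \<le> (\<Sum>i\<in>I. 2 * ((w i + r i + m0 i * \<eta> - m i * \<eta>)\<^sup>2 - (w i + r i)\<^sup>2)
      + 4 * \<eta> * ((m i - m0 i) * w i) + 4 * \<rho>\<^sup>2)" by (rule sum_mono)
  also have "\<dots> = 2 * ((\<Sum>i\<in>I. (w i + r i + m0 i * \<eta> - m i * \<eta>)\<^sup>2) - (\<Sum>i\<in>I. (w i + r i)\<^sup>2))
      + 4 * \<eta> * (\<Sum>i\<in>I. (m i - m0 i) * w i) + real (card I) * (4 * \<rho>\<^sup>2)"
    by (simp add: sum.distrib sum_subtractf sum_distrib_left)
  also have "\<dots> \<le> 4 * \<eta> * (\<Sum>i\<in>I. (m i - m0 i) * w i) + real (card I) * (4 * \<rho>\<^sup>2)"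
    using le by simp
  finally have "\<eta>\<^sup>2 * (\<Sum>i\<in>I. (m i - m0 i)\<^sup>2)
      \<le> 4 * \<eta> * (\<Sum>i\<in>I. (m i - m0 i) * w i) + real (card I) * (4 * \<rho>\<^sup>2)"
    by (simp only: sum_distrib_left)
  then have "\<eta>\<^sup>2 * (\<Sum>i\<in>I. (m i - m0 i)\<^sup>2) / \<eta>
      \<le> (4 * \<eta> * (\<Sum>i\<in>I. (m i - m0 i) * w i) + real (card I) * (4 * \<rho>\<^sup>2)) / \<eta>"
    using \<open>\<eta> > 0\<close> by (intro divide_right_mono) auto
  then show ?thesis using \<open>\<eta> > 0\<close> by (simp add: add_divide_distrib power2_eq_square mult_ac)
qed

text \<open>
  An observed increment is a noise increment plus the drift term of the true parameter plus an
  error of order \<open>(h n)\<^sup>2\<close> from replacing the integral of the drift by its left endpoint value; the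
  minimizer does at least as well as the true parameter.
\<close>
lemma contrast_minimizer_inequality:
  fixes \<mu> :: "'b \<Rightarrow> real \<Rightarrow> real"
  assumes min: "is_arg_min (contrast \<mu> h (observed \<mu> \<xi>\<^sub>0 Z) n \<omega>) (\<lambda>\<xi>. \<xi> \<in> S) \<xi>"
    and "\<xi>\<^sub>0 \<in> S" "h n > 0"
    and deriv: "\<And>t. t \<ge> 0 \<Longrightarrow> \<exists>D. (\<mu> \<xi>\<^sub>0 has_real_derivative D) (at t within {0..}) \<and> \<bar>D\<bar> \<le> C"
    and int: "\<And>t. t > 0 \<Longrightarrow> set_integrable lborel {0..t} (\<mu> \<xi>\<^sub>0)"
  shows "h n * (\<Sum>i=1..n. (\<mu> \<xi> (tgrid h n (i - 1)) - \<mu> \<xi>\<^sub>0 (tgrid h n (i - 1)))\<^sup>2)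
    \<le> 4 * (\<Sum>i=1..n. (\<mu> \<xi> (tgrid h n (i - 1)) - \<mu> \<xi>\<^sub>0 (tgrid h n (i - 1))) * increment h Z n i \<omega>)
      + 4 * real n * (C * (h n)\<^sup>2)\<^sup>2 / h n"
proof -
  define J where "J t = (LINT s:{0..t}|lborel. \<mu> \<xi>\<^sub>0 s)" for t
  define r where "r i = J (tgrid h n i) - J (tgrid h n (i - 1)) - \<mu> \<xi>\<^sub>0 (tgrid h n (i - 1)) * h n" for i
  have r: "\<bar>r i\<bar> \<le> C * (h n)\<^sup>2" if "i \<in> {1..n}" for i
  proof -
    let ?t = "tgrid h n i" and ?s = "tgrid h n (i - 1)"
    have "?t - ?s = h n" using that by (simp add: tgrid_def of_nat_diff algebra_simps)
    moreover have "0 \<le> ?s" "0 < ?t" using that \<open>h n > 0\<close> by (auto simp: tgrid_def)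
    ultimately show ?thesis
      using integral_minus_left_endpoint_rule[OF deriv, of ?s ?t] int[of ?t] \<open>h n > 0\<close>
      by (simp add: r_def J_def)
  qed
  have "contrast \<mu> h (observed \<mu> \<xi>\<^sub>0 Z) n \<omega> \<xi> \<le> contrast \<mu> h (observed \<mu> \<xi>\<^sub>0 Z) n \<omega> \<xi>\<^sub>0"
    using min \<open>\<xi>\<^sub>0 \<in> S\<close> by (auto simp: is_arg_min_linorder)
  then have "(\<Sum>i=1..n. (increment h Z n i \<omega> + r i + \<mu> \<xi>\<^sub>0 (tgrid h n (i - 1)) * h n
        - \<mu> \<xi> (tgrid h n (i - 1)) * h n)\<^sup>2) \<le> (\<Sum>i=1..n. (increment h Z n i \<omega> + r i)\<^sup>2)"
    by (simp add: contrast_def increment_def observed_def r_def J_def algebra_simps)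
  from least_squares_basic_inequality[OF \<open>h n > 0\<close> this r] show ?thesis by simp
qed

section \<open>Consistency of the estimator\<close>

theorem theorem3p1:
  fixes P :: "'a measure"
    and \<Xi> :: "(real ^ 'p) set" and \<xi>\<^sub>0 :: "real ^ 'p"
    and \<mu> :: "real ^ 'p \<Rightarrow> real \<Rightarrow> real"
    and Z :: "real \<Rightarrow> 'a \<Rightarrow> real" and K :: "real \<Rightarrow> real"
    and h a b :: "nat \<Rightarrow> real" and \<alpha> :: real
    and Q :: "real ^ 'p \<Rightarrow> real ^ 'p \<Rightarrow> real" and M :: "real \<Rightarrow> real"
    and \<xi>hat :: "nat \<Rightarrow> 'a \<Rightarrow> real ^ 'p"
  assumes "prob_space P"
    and "open \<Xi>" and "bounded \<Xi>" and "convex \<Xi>" and "\<xi>\<^sub>0 \<in> \<Xi>"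
    and mu_integrable: "\<And>\<xi> t. \<xi> \<in> closure \<Xi> \<Longrightarrow> t > 0 \<Longrightarrow> set_integrable lborel {0..t} (\<mu> \<xi>)"
    and noise: "centered_stationary_gaussian_process P K Z"
    and h_pos: "\<And>n. n \<ge> 1 \<Longrightarrow> h n > 0"
    and h_lim: "h \<longlonglongrightarrow> 0"
    and T_lim: "filterlim (\<lambda>n. real n * h n) at_top sequentially"
    and estimator_measurable: "\<And>n. n \<ge> 1 \<Longrightarrow> \<xi>hat n \<in> borel_measurable P"
    and estimator: "\<And>n \<omega>. n \<ge> 1 \<Longrightarrow> \<omega> \<in> space P \<Longrightarrow>
      is_arg_min (contrast \<mu> h (observed \<mu> \<xi>\<^sub>0 Z) n \<omega>) (\<lambda>\<xi>. \<xi> \<in> closure \<Xi>) (\<xi>hat n \<omega>)"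
    and alpha: "0 < \<alpha>" "\<alpha> \<le> 2"
    and A1: "\<exists>C>0. \<forall>n\<ge>1. \<forall>i\<in>{1..n}.
      (\<Sum>j=1..n. \<bar>covariance P (increment h Z n i) (increment h Z n j)\<bar>) \<le> C * h n powr \<alpha>"
    and B1: "\<And>t. t \<ge> 0 \<Longrightarrow> continuous_on (closure \<Xi>) (\<lambda>\<xi>. \<mu> \<xi> t)"
    and B3: "\<exists>C>0. \<forall>\<xi>\<in>closure \<Xi>. \<forall>t\<ge>0.
      \<exists>D. (\<mu> \<xi> has_real_derivative D) (at t within {0..}) \<and> \<bar>D\<bar> \<le> C"
    and B4_a: "filterlim a at_top sequentially"
    and B4_Q: "continuous_on (closure \<Xi> \<times> closure \<Xi>) (\<lambda>(\<xi>, \<eta>). Q \<xi> \<eta>)"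
      "\<And>\<xi> \<eta>. \<xi> \<in> closure \<Xi> \<Longrightarrow> \<eta> \<in> closure \<Xi> \<Longrightarrow> Q \<xi> \<eta> \<ge> 0"
    and B4_lim: "uniform_limit (closure \<Xi>)
      (\<lambda>n \<xi>. 1 / a n * (\<Sum>i=1..n. (\<mu> \<xi> (tgrid h n (i - 1)) - \<mu> \<xi>\<^sub>0 (tgrid h n (i - 1)))\<^sup>2))
      (\<lambda>\<xi>. Q \<xi> \<xi>\<^sub>0) sequentially"
    and B4_ident: "\<And>\<xi>. \<xi> \<in> closure \<Xi> \<Longrightarrow> Q \<xi> \<xi>\<^sub>0 = 0 \<longleftrightarrow> \<xi> = \<xi>\<^sub>0"
    and B5_b: "filterlim b at_top sequentially"
    and B5_M: "M \<in> borel_measurable (restrict_space borel {0..})" "\<And>t. t \<ge> 0 \<Longrightarrow> M t \<ge> 0"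
    and B5_grad: "\<And>\<xi> t. \<xi> \<in> closure \<Xi> \<Longrightarrow> t \<ge> 0 \<Longrightarrow>
      \<exists>g. has_gradient_within (\<lambda>\<eta>. \<mu> \<eta> t) g \<xi> (closure \<Xi>) \<and> norm g \<le> M t"
    and B5_bound: "(\<lambda>n. 1 / b n * (\<Sum>i=1..n. (M (tgrid h n (i - 1)))\<^sup>2)) \<in> O(\<lambda>_. 1)"
    and rate1: "filterlim (\<lambda>n. a n * h n powr (2 - \<alpha>)) at_top sequentially"
    and rate2: "(\<lambda>n. real n * (h n)\<^sup>2 / a n) \<longlonglongrightarrow> 0"
    and rate3: "b \<in> O(a)"
  shows "converges_in_probability P \<xi>hat (\<lambda>_. \<xi>\<^sub>0)"
proof -
  interpret prob_space P by fact
  let ?S = "closure \<Xi>"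
  let ?q = "4 * DIM(real ^ 'p) + 2"
  let ?m = "2 * DIM(real ^ 'p) + 1"
  have S: "compact ?S" "bounded ?S" "convex ?S" "\<xi>\<^sub>0 \<in> ?S"
    using assms(3-5) closure_subset by (auto simp: compact_eq_bounded_closed intro: convex_closure)
  obtain C1 where C1: "C1 > 0" "\<And>n i. n \<ge> 1 \<Longrightarrow> i \<in> {1..n} \<Longrightarrow>
      (\<Sum>j=1..n. \<bar>covariance P (increment h Z n i) (increment h Z n j)\<bar>) \<le> C1 * h n powr \<alpha>"
    using A1 by blast
  obtain C3 where C3: "\<And>\<xi> t. \<xi> \<in> ?S \<Longrightarrow> t \<ge> 0 \<Longrightarrow>
      \<exists>D. (\<mu> \<xi> has_real_derivative D) (at t within {0..}) \<and> \<bar>D\<bar> \<le> C3"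
    using B3 by blast
  obtain CM where CM: "CM > 0"
    "\<forall>\<^sub>F n in sequentially. \<bar>1 / b n * (\<Sum>i=1..n. (M (tgrid h n (i - 1)))\<^sup>2)\<bar> \<le> CM"
    using landau_o.bigE[OF B5_bound] by auto
  obtain Cb where Cb: "Cb > 0" "\<forall>\<^sub>F n in sequentially. \<bar>b n\<bar> \<le> Cb * \<bar>a n\<bar>"
    using landau_o.bigE[OF rate3] by auto
  have "\<forall>\<^sub>F n in sequentially. n \<ge> 1 \<and> a n > 0 \<and> b n > 0 \<and>
      \<bar>1 / b n * (\<Sum>i=1..n. (M (tgrid h n (i - 1)))\<^sup>2)\<bar> \<le> CM \<and> \<bar>b n\<bar> \<le> Cb * \<bar>a n\<bar>"
    using B4_a B5_b CM(2) Cb(2) eventually_ge_at_top[of 1]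
    by (auto simp: filterlim_at_top_dense eventually_conj_iff)
  then obtain N where N: "\<And>n. n \<ge> N \<Longrightarrow> n \<ge> 1" "\<And>n. n \<ge> N \<Longrightarrow> a n > 0" "\<And>n. n \<ge> N \<Longrightarrow> b n > 0"
    "\<And>n. n \<ge> N \<Longrightarrow> \<bar>1 / b n * (\<Sum>i=1..n. (M (tgrid h n (i - 1)))\<^sup>2)\<bar> \<le> CM"
    "\<And>n. n \<ge> N \<Longrightarrow> \<bar>b n\<bar> \<le> Cb * \<bar>a n\<bar>"
    unfolding eventually_sequentially by blast
  have sum_M: "(\<Sum>i=1..n. (M (tgrid h n (i - 1)))\<^sup>2) \<le> CM * Cb * a n" if n: "n \<ge> N" for n
  proof -
    have "(\<Sum>i=1..n. (M (tgrid h n (i - 1)))\<^sup>2) / b n \<le> CM"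
      using abs_le_D1[OF N(4)[OF n]] by simp
    then have "(\<Sum>i=1..n. (M (tgrid h n (i - 1)))\<^sup>2) \<le> CM * b n"
      using N(3)[OF n] by (simp add: divide_le_eq)
    also have "\<dots> \<le> CM * (Cb * a n)"
      using N(2,3,5)[OF n] CM(1) by (intro mult_left_mono) auto
    finally show ?thesis by (simp add: mult.assoc)
  qed
  have tgrid_nonneg: "tgrid h n i \<ge> 0" if "n \<ge> N" for n i
    using h_pos[OF N(1)[OF that]] by (simp add: tgrid_def)
  have lip: "(\<mu> u t - \<mu> v t)\<^sup>2 \<le> (M t)\<^sup>2 * (dist u v)\<^sup>2" if "u \<in> ?S" "v \<in> ?S" "t \<ge> 0" for u v t
  proof -
    have "\<bar>\<mu> u t - \<mu> v t\<bar> \<le> M t * dist u v"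
      using has_gradient_within_bounded_imp_lipschitz[OF S(3) B5_grad[OF _ \<open>t \<ge> 0\<close>] that(1,2)] .
    then show ?thesis
      by (metis abs_ge_zero power2_abs power_mono power_mult_distrib)
  qed

  \<comment> \<open>The normalised noise term, the normalised squared distance of the drifts (whose limit is
    \<^term>\<open>Q\<close>), and the factor in front of \<^term>\<open>(dist u v)\<^sup>2\<close> in the
    variance of the increments of \<^term>\<open>G n\<close>. The step \<^term>\<open>h n\<close> in the
    normalisation of \<^term>\<open>G n\<close> is the one that multiplies the drift in the contrast.\<close>
  define G where "G n \<xi> \<omega> = (\<Sum>i=1..n.
      (\<mu> \<xi> (tgrid h n (i - 1)) - \<mu> \<xi>\<^sub>0 (tgrid h n (i - 1))) / (a n * h n)
      * increment h Z n i \<omega>)" for n \<xi> \<omega>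
  define V where "V n \<xi> = 1 / a n *
      (\<Sum>i=1..n. (\<mu> \<xi> (tgrid h n (i - 1)) - \<mu> \<xi>\<^sub>0 (tgrid h n (i - 1)))\<^sup>2)" for n \<xi>
  define \<tau> where "\<tau> n = C1 * CM * Cb / (a n * h n powr (2 - \<alpha>))" for n
  define L where "L n = fact (2 * ?m) / (2 ^ ?m * fact ?m) * \<tau> n ^ ?m" for n
  have "\<tau> \<longlonglongrightarrow> 0"
    unfolding \<tau>_def by (rule tendsto_divide_0[OF tendsto_const filterlim_at_top_imp_at_infinity[OF rate1]])
  then have "L \<longlonglongrightarrow> fact (2 * ?m) / (2 ^ ?m * fact ?m) * 0 ^ ?m"
    unfolding L_def by (intro tendsto_intros)
  then have L_lim: "L \<longlonglongrightarrow> 0" by simp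
  have \<tau>_nonneg: "\<tau> n \<ge> 0" if "n \<ge> N" for n
    using N(2)[OF that] C1(1) CM(1) Cb(1) by (simp add: \<tau>_def)
  have G_moment: "integrable P (\<lambda>\<omega>. (G n u \<omega> - G n v \<omega>) ^ ?q)"
    "integral\<^sup>L P (\<lambda>\<omega>. (G n u \<omega> - G n v \<omega>) ^ ?q) \<le> L n * dist u v ^ ?q"
    if n: "n \<ge> N" and uv: "u \<in> ?S" "v \<in> ?S" for n u v
  proof -
    define c where "c i = (\<mu> u (tgrid h n (i - 1)) - \<mu> v (tgrid h n (i - 1))) / (a n * h n)" for i
    have pos: "a n > 0" "h n > 0" using N(2)[OF n] h_pos[OF N(1)[OF n]] by auto
    have diff: "G n u \<omega> - G n v \<omega> = (\<Sum>i=1..n. c i * increment h Z n i \<omega>)" for \<omega>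
      unfolding G_def c_def by (simp add: sum_subtractf[symmetric] diff_divide_distrib algebra_simps)
    have q: "?q = 2 * ?m" by simp
    note mom = increments_combination_moment[OF \<open>prob_space P\<close> noise less_imp_le[OF pos(2)]
        C1(2)[OF N(1)[OF n]], where c = c and m = ?m]
    show "integrable P (\<lambda>\<omega>. (G n u \<omega> - G n v \<omega>) ^ ?q)"
      unfolding diff q using mom(1) .
    have "(\<Sum>i=1..n. (c i)\<^sup>2) \<le> (\<Sum>i=1..n. (M (tgrid h n (i - 1)))\<^sup>2 * (dist u v)\<^sup>2 / (a n * h n)\<^sup>2)"
      unfolding c_def power_divide using lip[OF uv tgrid_nonneg[OF n]]
      by (intro sum_mono divide_right_mono) auto
    also have "\<dots> = (\<Sum>i=1..n. (M (tgrid h n (i - 1)))\<^sup>2) * ((dist u v)\<^sup>2 / (a n * h n)\<^sup>2)"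
      by (simp add: sum_distrib_right sum_divide_distrib)
    also have "\<dots> \<le> CM * Cb * a n * ((dist u v)\<^sup>2 / (a n * h n)\<^sup>2)"
      using sum_M[OF n] by (intro mult_right_mono) auto
    finally have "C1 * h n powr \<alpha> * (\<Sum>i=1..n. (c i)\<^sup>2)
        \<le> C1 * h n powr \<alpha> * (CM * Cb * a n * ((dist u v)\<^sup>2 / (a n * h n)\<^sup>2))"
      using C1(1) by (intro mult_left_mono) auto
    also have "\<dots> = \<tau> n * (dist u v)\<^sup>2"
      using pos by (simp add: \<tau>_def powr_diff powr_numeral power_mult_distrib field_simps power2_eq_square)
    finally have "C1 * h n powr \<alpha> * (\<Sum>i=1..n. (c i)\<^sup>2) \<le> \<tau> n * (dist u v)\<^sup>2" .
    moreover have "0 \<le> C1 * h n powr \<alpha> * (\<Sum>i=1..n. (c i)\<^sup>2)"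
      using C1(1) by (intro mult_nonneg_nonneg sum_nonneg) auto
    ultimately have "(C1 * h n powr \<alpha> * (\<Sum>i=1..n. (c i)\<^sup>2)) ^ ?m \<le> (\<tau> n * (dist u v)\<^sup>2) ^ ?m"
      by (rule power_mono)
    also have "\<dots> = \<tau> n ^ ?m * dist u v ^ ?q"
      unfolding q by (simp only: power_mult_distrib power_mult)
    finally have "fact (2 * ?m) / (2 ^ ?m * fact ?m) * (C1 * h n powr \<alpha> * (\<Sum>i=1..n. (c i)\<^sup>2)) ^ ?m
        \<le> fact (2 * ?m) / (2 ^ ?m * fact ?m) * (\<tau> n ^ ?m * dist u v ^ ?q)"
      by (rule mult_left_mono) simp
    from order_trans[OF mom(2) this]
    show "integral\<^sup>L P (\<lambda>\<omega>. (G n u \<omega> - G n v \<omega>) ^ ?q) \<le> L n * dist u v ^ ?q"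
      unfolding diff L_def q by (simp only: mult.assoc)
  qed
  have inc_meas: "increment h Z n i \<in> borel_measurable P" if "n \<ge> N" for n i
    using stationary_gaussian_increment(1)[OF \<open>prob_space P\<close> noise, of h n i] h_pos[OF N(1)[OF that]]
    by (simp add: gaussian_rv_def)
  have G_meas: "G n \<xi> \<in> borel_measurable P" if "n \<ge> N" for n \<xi>
    unfolding G_def[abs_def] using inc_meas[OF that] by measurable
  have G_cont: "continuous_on ?S (\<lambda>\<xi>. G n \<xi> \<omega>)" if "n \<ge> N" for n \<omega>
    unfolding G_def divide_inverse using tgrid_nonneg[OF that] by (intro continuous_intros B1)

  show ?thesis
    unfolding converges_in_probability_def
  proof (intro allI impI)
    fix \<epsilon> :: real assume "\<epsilon> > 0"
    \<comment> \<open>By compactness, identifiability gives a positive lower bound of the limit away from the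
      true parameter.\<close>
    define S\<epsilon> where "S\<epsilon> = ?S - ball \<xi>\<^sub>0 \<epsilon>"
    have "compact S\<epsilon>" unfolding S\<epsilon>_def using S(1) by (intro compact_diff) auto
    have Q_cont: "continuous_on S\<epsilon> (\<lambda>\<xi>. Q \<xi> \<xi>\<^sub>0)"
    proof -
      have "continuous_on S\<epsilon> ((\<lambda>(\<xi>, \<eta>). Q \<xi> \<eta>) \<circ> (\<lambda>\<xi>. (\<xi>, \<xi>\<^sub>0)))"
        using S(4) by (intro continuous_on_compose continuous_intros continuous_on_subset[OF B4_Q(1)])
          (auto simp: S\<epsilon>_def)
      then show ?thesis by (simp add: comp_def)
    qed
    obtain \<kappa> where \<kappa>: "\<kappa> > 0" "\<And>\<xi>. \<xi> \<in> S\<epsilon> \<Longrightarrow> \<kappa> \<le> Q \<xi> \<xi>\<^sub>0"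
    proof (cases "S\<epsilon> = {}")
      case True then show thesis using that[of 1] by auto
    next
      case False
      then obtain \<xi>1 where \<xi>1: "\<xi>1 \<in> S\<epsilon>" "\<And>\<xi>. \<xi> \<in> S\<epsilon> \<Longrightarrow> Q \<xi>1 \<xi>\<^sub>0 \<le> Q \<xi> \<xi>\<^sub>0"
        using continuous_attains_inf[OF \<open>compact S\<epsilon>\<close> _ Q_cont] by blast
      have "\<xi>1 \<in> ?S" "\<xi>1 \<noteq> \<xi>\<^sub>0" using \<xi>1(1) \<open>\<epsilon> > 0\<close> by (auto simp: S\<epsilon>_def)
      then have "Q \<xi>1 \<xi>\<^sub>0 > 0" using B4_Q(2)[of \<xi>1 \<xi>\<^sub>0] B4_ident[of \<xi>1] S(4) by force
      then show thesis using that \<xi>1(2) by blast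
    qed
    obtain B F where BF: "F \<longlonglongrightarrow> 0" "\<And>n. n \<ge> N \<Longrightarrow> B n \<in> sets P" "\<And>n. n \<ge> N \<Longrightarrow> measure P (B n) \<le> F n"
      "\<And>n \<omega> \<xi>. n \<ge> N \<Longrightarrow> \<omega> \<in> space P \<Longrightarrow> \<omega> \<notin> B n \<Longrightarrow> \<xi> \<in> ?S \<Longrightarrow> \<bar>G n \<xi> \<omega>\<bar> \<le> \<kappa> / 16"
    proof (rule uniformly_small_in_probability[OF \<open>prob_space P\<close> S(2) S(4) L_lim, of N G "\<kappa> / 16"])
      show "G n \<xi>\<^sub>0 \<omega> = 0" for n \<omega> by (simp add: G_def)
      show "L n \<ge> 0" if "n \<ge> N" for n using \<tau>_nonneg[OF that] by (simp add: L_def)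
    qed (use G_meas G_cont G_moment \<kappa>(1) that in auto)
    have "(\<lambda>n. 4 * C3\<^sup>2 * (real n * (h n)\<^sup>2 / a n)) \<longlonglongrightarrow> 4 * C3\<^sup>2 * 0"
      by (intro tendsto_intros rate2)
    then have bias: "\<forall>\<^sub>F n in sequentially. 4 * C3\<^sup>2 * (real n * (h n)\<^sup>2 / a n) < \<kappa> / 4"
      by (rule order_tendstoD(2)) (use \<kappa>(1) in simp)
    have "\<forall>\<^sub>F n in sequentially. \<forall>\<xi>\<in>?S. dist (V n \<xi>) (Q \<xi> \<xi>\<^sub>0) < \<kappa> / 4"
      using uniform_limitD[OF B4_lim, of "\<kappa> / 4"] \<kappa>(1) by (simp add: V_def)
    with bias eventually_ge_at_top[of N]
    have "\<forall>\<^sub>F n in sequentially. measure P {\<omega> \<in> space P. dist (\<xi>hat n \<omega>) \<xi>\<^sub>0 > \<epsilon>} \<le> F n"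
    proof eventually_elim
      case (elim n)
      have pos: "a n > 0" "h n > 0" "n \<ge> 1" using N(1,2)[OF elim(2)] h_pos by auto
      have "{\<omega> \<in> space P. dist (\<xi>hat n \<omega>) \<xi>\<^sub>0 > \<epsilon>} \<subseteq> B n"
      proof (rule subsetI, rule ccontr)
        fix \<omega> assume "\<omega> \<in> {\<omega> \<in> space P. dist (\<xi>hat n \<omega>) \<xi>\<^sub>0 > \<epsilon>}" and nB: "\<omega> \<notin> B n"
        then have \<omega>: "\<omega> \<in> space P" "dist (\<xi>hat n \<omega>) \<xi>\<^sub>0 > \<epsilon>" by auto
        note min = estimator[OF pos(3) \<omega>(1)]
        let ?x = "\<xi>hat n \<omega>"
        have x: "?x \<in> ?S" using min by (simp add: is_arg_min_def)
        then have "?x \<in> S\<epsilon>" using \<omega>(2) by (auto simp: S\<epsilon>_def dist_commute)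
        from \<kappa>(2)[OF this] bspec[OF elim(3) x] have lower: "V n ?x > 3 / 4 * \<kappa>"
          unfolding dist_real_def by linarith
        let ?d = "\<lambda>i. \<mu> ?x (tgrid h n (i - 1)) - \<mu> \<xi>\<^sub>0 (tgrid h n (i - 1))"
        have "h n * (\<Sum>i=1..n. (?d i)\<^sup>2) \<le> 4 * (\<Sum>i=1..n. ?d i * increment h Z n i \<omega>)
            + 4 * real n * (C3 * (h n)\<^sup>2)\<^sup>2 / h n"
          using contrast_minimizer_inequality[OF min S(4) pos(2) C3[OF S(4)] mu_integrable[OF S(4)]] .
        then have "h n * (\<Sum>i=1..n. (?d i)\<^sup>2) / (a n * h n) \<le> (4 * (\<Sum>i=1..n. ?d i * increment h Z n i \<omega>)
            + 4 * real n * (C3 * (h n)\<^sup>2)\<^sup>2 / h n) / (a n * h n)"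
          using pos by (intro divide_right_mono) auto
        also have "h n * (\<Sum>i=1..n. (?d i)\<^sup>2) / (a n * h n) = V n ?x"
          using pos by (simp add: V_def)
        also have "(4 * (\<Sum>i=1..n. ?d i * increment h Z n i \<omega>)
            + 4 * real n * (C3 * (h n)\<^sup>2)\<^sup>2 / h n) / (a n * h n)
            = 4 * G n ?x \<omega> + 4 * C3\<^sup>2 * (real n * (h n)\<^sup>2 / a n)"
        proof -
          have "G n ?x \<omega> = (\<Sum>i=1..n. ?d i * increment h Z n i \<omega>) / (a n * h n)"
            by (simp add: G_def sum_divide_distrib)
          then show ?thesis
            using pos by (simp add: add_divide_distrib power2_eq_square)
        qed
        finally have "V n ?x \<le> 4 * G n ?x \<omega> + 4 * C3\<^sup>2 * (real n * (h n)\<^sup>2 / a n)" .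
        moreover have "\<bar>G n ?x \<omega>\<bar> \<le> \<kappa> / 16" using BF(4)[OF elim(2) \<omega>(1) nB x] .
        \<comment> \<open>Four times the noise bound and the bias together stay below
          \<^term>\<open>\<kappa> / 2\<close>, whereas the left-hand side exceeds
          \<^term>\<open>3 / 4 * \<kappa>\<close>.\<close>
        ultimately show False using lower elim(1) \<kappa>(1) by linarith
      qed
      then have "measure P {\<omega> \<in> space P. dist (\<xi>hat n \<omega>) \<xi>\<^sub>0 > \<epsilon>} \<le> measure P (B n)"
        using BF(2)[OF elim(2)] by (intro finite_measure_mono) auto
      then show ?case using BF(3)[OF elim(2)] by linarith
    qed
    then show "(\<lambda>n. measure P {\<omega> \<in> space P. dist (\<xi>hat n \<omega>) \<xi>\<^sub>0 > \<epsilon>}) \<longlonglongrightarrow> 0"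
      by (intro Lim_null_comparison[OF _ BF(1)]) simp
  qed
qed

end
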